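(* Let $R = R_0[x_1,\ldots,x_d]$ be a commutative Noetherian $\mathbb{N}$-graded algebra, where $R_0$ is the degree-$0$ component of $R$ and the $x_i$ are homogeneous with $\deg(x_i)\ge 1$ for $1\le i\le d$, and let $M$ be a finitely generated $\mathbb{Z}$-graded $R$-module. Let $\mathfrak{p}\in\mathrm{Ass}_R(M)$. Set $X_{\mathfrak{p}} := \{\mathfrak{q} \in \mathrm{Ass}_R(M) : \mathfrak{p} \subsetneq \mathfrak{q} \}$. Let $V=R$ if $X_{\mathfrak{p}}=\emptyset$, and otherwise let $V = \prod_{\mathfrak{q}\in X_{\mathfrak{p}}}\mathfrak{q}$. Then $$v_{\mathfrak{p}}(M) = \mathrm{indeg}\big(\mathrm{ann}_M(\mathfrak{p})/(\mathrm{ann}_M(\mathfrak{p})\cap\Gamma_V(M))\big).$$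
   Context: For $\mathfrak{p}\in\mathrm{Ass}_R(M)$, the v-number of $M$ at $\mathfrak{p}$ is $v_{\mathfrak{p}}(M) := \inf\{ u : \text{there exists } x\in M_u \text{ such that } \mathfrak{p} = (0:_R x)\}$, where $M_u$ is the degree-$u$ component of $M$. For a graded module $L$, $\mathrm{indeg}(L) := \inf\{n : L_n\neq 0\}$, with $\mathrm{indeg}(0)=\infty$. For an ideal $\mathfrak{b}$ of $R$, $\mathrm{ann}_M(\mathfrak{b}) := (0:_M\mathfrak{b})=\{x\in M:\mathfrak{b}x=0\}$ and $\Gamma_{\mathfrak{b}}(M) := \bigcup_{n\ge 1}(0:_M\mathfrak{b}^n)$. *)

theory Defs
  imports "HOL-Algebra.Algebra" "HOL-Library.Extended_Real"
begin

section \<open>Graded rings and modules\<close>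

definition internal_direct_sum ::
    "('b, 'm) ring_scheme \<Rightarrow> ('i \<Rightarrow> 'b set) \<Rightarrow> bool" where
  "internal_direct_sum G g \<longleftrightarrow>
     (\<forall>i. additive_subgroup (g i) G) \<and>
     (\<forall>x\<in>carrier G. \<exists>!f. (\<forall>i. f i \<in> g i) \<and> finite {i. f i \<noteq> \<zero>\<^bsub>G\<^esub>} \<and>
        x = (\<Oplus>\<^bsub>G\<^esub>i\<in>{i. f i \<noteq> \<zero>\<^bsub>G\<^esub>}. f i))"

text \<open>Only multiplicativity is required of the grading of a ring; that the unit has degree 0, hence
  that the component of degree 0 is a subring, follows.\<close>

locale nat_graded_ring = cring R for R (structure) +
  fixes Rg :: "nat \<Rightarrow> 'a set"
  assumes ring_decomp: "internal_direct_sum R Rg"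
    and mult_degree: "\<lbrakk>a \<in> Rg i; b \<in> Rg j\<rbrakk> \<Longrightarrow> a \<otimes> b \<in> Rg (i + j)"

locale int_graded_module = R?: nat_graded_ring R Rg + M?: module R M
  for R (structure) and Rg and M (structure) +
  fixes Mg :: "int \<Rightarrow> 'c set"
  assumes module_decomp: "internal_direct_sum M Mg"
    and smult_degree: "\<lbrakk>a \<in> Rg i; x \<in> Mg j\<rbrakk> \<Longrightarrow> a \<odot>\<^bsub>M\<^esub> x \<in> Mg (int i + j)"

definition gen_submodule ::
    "('a, 'r) ring_scheme \<Rightarrow> ('a, 'b, 'm) module_scheme \<Rightarrow> 'b set \<Rightarrow> 'b set" where
  "gen_submodule R M S = \<Inter>{N. submodule N R M \<and> S \<subseteq> N}"

definition fin_gen_module ::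
    "('a, 'r) ring_scheme \<Rightarrow> ('a, 'b, 'm) module_scheme \<Rightarrow> bool" where
  "fin_gen_module R M \<longleftrightarrow>
     (\<exists>S\<subseteq>carrier M. finite S \<and> gen_submodule R M S = carrier M)"

section \<open>Annihilators, associated primes and torsion\<close>

definition ann_elem ::
    "('a, 'r) ring_scheme \<Rightarrow> ('a, 'b, 'm) module_scheme \<Rightarrow> 'b \<Rightarrow> 'a set" where
  "ann_elem R M x = {a \<in> carrier R. a \<odot>\<^bsub>M\<^esub> x = \<zero>\<^bsub>M\<^esub>}"

definition Ass ::
    "('a, 'r) ring_scheme \<Rightarrow> ('a, 'b, 'm) module_scheme \<Rightarrow> 'a set set" where
  "Ass R M = {p. primeideal p R \<and> (\<exists>x\<in>carrier M. p = ann_elem R M x)}"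

definition ann_ideal :: "('a, 'b, 'm) module_scheme \<Rightarrow> 'a set \<Rightarrow> 'b set" where
  "ann_ideal M I = {x \<in> carrier M. \<forall>a\<in>I. a \<odot>\<^bsub>M\<^esub> x = \<zero>\<^bsub>M\<^esub>}"

text \<open>Products and powers of ideals are taken in the commutative monoid \<^const>\<open>ideals_set\<close>.\<close>

definition torsion ::
    "('a, 'r) ring_scheme \<Rightarrow> ('a, 'b, 'm) module_scheme \<Rightarrow> 'a set \<Rightarrow> 'b set" where
  "torsion R M I = (\<Union>n\<in>{1::nat..}. ann_ideal M (I [^]\<^bsub>ideals_set R\<^esub> n))"

section \<open>Quotients of graded modules, initial degree and v-number\<close>

text \<open>The fields \<^const>\<open>monoid.mult\<close> and \<^const>\<open>monoid.one\<close> of a module record carry no meaning. As in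
  \<^const>\<open>rcoset_mult\<close>, the operation on cosets is the union over all representatives.\<close>

definition quot_module ::
    "('a, 'b, 'm) module_scheme \<Rightarrow> 'b set \<Rightarrow> ('a, 'b set) module" where
  "quot_module N W =
     \<lparr>carrier = a_rcosets\<^bsub>N\<^esub> W, monoid.mult = undefined, monoid.one = undefined,
      ring.zero = W, add = set_add N,
      smult = (\<lambda>a C. \<Union>x\<in>C. W +>\<^bsub>N\<^esub> (a \<odot>\<^bsub>N\<^esub> x))\<rparr>"

definition quot_grading ::
    "('a, 'b, 'm) module_scheme \<Rightarrow> ('i \<Rightarrow> 'b set) \<Rightarrow> 'b set \<Rightarrow> 'i \<Rightarrow> 'b set set" where
  "quot_grading N Ng W n = (\<lambda>x. W +>\<^bsub>N\<^esub> x) ` Ng n"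

lemma quot_module_is_module:
  assumes "module R N" and "submodule W R N"
  shows "module R (quot_module N W)"
proof -
  interpret R?: module R N by fact
  have sub: "subgroup W (add_monoid N)" using assms(2) by (simp add: submodule_def)
  interpret abelian_subgroup W N
    by (rule abelian_subgroupI3) (simp_all add: additive_subgroup_def sub M.abelian_group_axioms)
  have rep: "\<exists>x\<in>carrier N. C = W +>\<^bsub>N\<^esub> x" if "C \<in> a_rcosets\<^bsub>N\<^esub> W" for C
    using that by (auto simp: A_RCOSETS_def')
  have mem: "W +>\<^bsub>N\<^esub> x \<in> a_rcosets\<^bsub>N\<^esub> W" if "x \<in> carrier N" for x
    using that by (auto simp: A_RCOSETS_def')
  have sm: "(\<Union>y\<in>W +>\<^bsub>N\<^esub> x. W +>\<^bsub>N\<^esub> (a \<odot>\<^bsub>N\<^esub> y)) = W +>\<^bsub>N\<^esub> (a \<odot>\<^bsub>N\<^esub> x)"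
    if a: "a \<in> carrier R" and x: "x \<in> carrier N" for a x
  proof -
    have "W +>\<^bsub>N\<^esub> (a \<odot>\<^bsub>N\<^esub> y) = W +>\<^bsub>N\<^esub> (a \<odot>\<^bsub>N\<^esub> x)" if "y \<in> W +>\<^bsub>N\<^esub> x" for y
    proof -
      from that obtain w where w: "w \<in> W" and y: "y = w \<oplus>\<^bsub>N\<^esub> x"
        by (auto simp: a_r_coset_def')
      have wc: "w \<in> carrier N" using w a_subset by blast
      have "a \<odot>\<^bsub>N\<^esub> y = a \<odot>\<^bsub>N\<^esub> w \<oplus>\<^bsub>N\<^esub> a \<odot>\<^bsub>N\<^esub> x"
        using a x wc y by (simp add: smult_r_distr)
      moreover have "a \<odot>\<^bsub>N\<^esub> w \<in> W" using submodule.smult_closed[OF assms(2) a w] .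
      ultimately have "a \<odot>\<^bsub>N\<^esub> y \<in> W +>\<^bsub>N\<^esub> (a \<odot>\<^bsub>N\<^esub> x)"
        by (auto simp: a_r_coset_def')
      then show ?thesis using a_repr_independence[OF _ _ sub] a x by (metis smult_closed)
    qed
    moreover have "x \<in> W +>\<^bsub>N\<^esub> x" using a_rcos_self x by blast
    ultimately show ?thesis by blast
  qed
  have W0: "W = W +>\<^bsub>N\<^esub> \<zero>\<^bsub>N\<^esub>"
    using M.a_coset_add_zero[OF a_subset] by simp
  have addc: "(W +>\<^bsub>N\<^esub> x) <+>\<^bsub>N\<^esub> (W +>\<^bsub>N\<^esub> y) = W +>\<^bsub>N\<^esub> (x \<oplus>\<^bsub>N\<^esub> y)"
    if "x \<in> carrier N" "y \<in> carrier N" for x y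
    using that by (rule a_rcos_sum)
  have inv: "\<exists>D\<in>a_rcosets\<^bsub>N\<^esub> W. D <+>\<^bsub>N\<^esub> C = W" if C: "C \<in> a_rcosets\<^bsub>N\<^esub> W" for C
  proof -
    obtain x where x: "x \<in> carrier N" and Cx: "C = W +>\<^bsub>N\<^esub> x" using rep[OF C] by blast
    have "(W +>\<^bsub>N\<^esub> (\<ominus>\<^bsub>N\<^esub> x)) <+>\<^bsub>N\<^esub> C = W +>\<^bsub>N\<^esub> \<zero>\<^bsub>N\<^esub>"
      using x by (simp add: Cx addc M.l_neg)
    then show ?thesis using mem[of "\<ominus>\<^bsub>N\<^esub> x"] x W0 by auto
  qed
  have W_mem: "W \<in> a_rcosets\<^bsub>N\<^esub> W" using mem[of "\<zero>\<^bsub>N\<^esub>"] W0 by simp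
  have l_zero: "W <+>\<^bsub>N\<^esub> C = C" if C: "C \<in> a_rcosets\<^bsub>N\<^esub> W" for C
  proof -
    obtain x where x: "x \<in> carrier N" and Cx: "C = W +>\<^bsub>N\<^esub> x" using rep[OF C] by blast
    show ?thesis using addc[of "\<zero>\<^bsub>N\<^esub>" x] x W0 Cx by simp
  qed
  have ag: "abelian_group (quot_module N W)"
    by (rule abelian_groupI)
       (auto simp: quot_module_def mem addc M.a_ac W_mem l_zero inv dest!: rep)
  have smQ: "a \<odot>\<^bsub>quot_module N W\<^esub> (W +>\<^bsub>N\<^esub> x) = W +>\<^bsub>N\<^esub> (a \<odot>\<^bsub>N\<^esub> x)"
    if "a \<in> carrier R" and "x \<in> carrier N" for a x
    using sm[OF that] by (simp add: quot_module_def)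
  have addQ: "(W +>\<^bsub>N\<^esub> x) \<oplus>\<^bsub>quot_module N W\<^esub> (W +>\<^bsub>N\<^esub> y) = W +>\<^bsub>N\<^esub> (x \<oplus>\<^bsub>N\<^esub> y)"
    if "x \<in> carrier N" and "y \<in> carrier N" for x y
    using addc[OF that] by (simp add: quot_module_def)
  have carrQ: "carrier (quot_module N W) = a_rcosets\<^bsub>N\<^esub> W"
    by (simp add: quot_module_def)
  show ?thesis
    by (rule moduleI[OF R.is_cring ag]; unfold carrQ; (drule rep)+; (elim bexE)?; hypsubst?)
       (simp_all add: mem smQ addQ smult_l_distr smult_r_distr smult_assoc1)
qed

text \<open>The infima are taken in the extended reals, so that the infimum of the empty set is
  \<open>\<infinity>\<close>, and that of a set of integers unbounded below is \<open>-\<infinity>\<close>.\<close>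

definition indeg :: "('b, 'm) ring_scheme \<Rightarrow> (int \<Rightarrow> 'b set) \<Rightarrow> ereal" where
  "indeg L Lg = (INF n\<in>{n. Lg n \<noteq> {\<zero>\<^bsub>L\<^esub>}}. ereal (of_int n))"

definition v_number ::
    "('a, 'r) ring_scheme \<Rightarrow> ('a, 'b, 'm) module_scheme \<Rightarrow> (int \<Rightarrow> 'b set) \<Rightarrow> 'a set \<Rightarrow> ereal" where
  "v_number R M Mg p = (INF u\<in>{u. \<exists>x\<in>Mg u. p = ann_elem R M x}. ereal (of_int u))"

end

theory Submission
  imports Defs
begin

text \<open>Both sides are infima over the same set of degrees: for every \<open>y\<close> in \<open>M\<close>, homogeneous or not,
  \<open>p = ann y\<close> holds if and only if \<open>y\<close> is annihilated by \<open>p\<close> and does not lie in \<open>T = \<Gamma>\<^sub>V(M)\<close>.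

  If \<open>ann y = p\<close> and \<open>V\<^sup>n y = 0\<close>, then \<open>V \<subseteq> p\<close>, so some \<open>q\<close> in \<open>X\<^sub>p\<close> is contained in \<open>p\<close>, which is absurd.
  Conversely, let \<open>p y = 0\<close> and \<open>y \<notin> T\<close>. As \<open>R\<close> is Noetherian, some \<open>q = (T : a y)\<close> is prime, and the chain of the
  ideals \<open>((0 :\<^sub>M V\<^sup>n) : a y)\<close> is stationary, so \<open>q V\<^sup>n a y = 0\<close> for some \<open>n\<close>. Then \<open>V\<close> is not contained in
  \<open>q\<close>, and \<open>q = ann (v a y)\<close> for every \<open>v\<close> in \<open>V\<^sup>n - q\<close>. Hence \<open>q\<close> is an associated prime containing
  \<open>ann y \<supseteq> p\<close> but not in \<open>X\<^sub>p\<close>, that is, \<open>q = p = ann y\<close>.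

  Finiteness of \<open>X\<^sub>p\<close> matters, since the product over an infinite set is the unit ideal.\<close>

text \<open>For a submodule \<open>N\<close> this is the annihilator of the class of
  \<open>x\<close> in \<open>M / N\<close>, written so that no quotient module has to be
  formed.\<close>

definition colon ::
    "('a, 'r) ring_scheme \<Rightarrow> ('a, 'b, 'm) module_scheme \<Rightarrow> 'b set \<Rightarrow> 'b \<Rightarrow> 'a set" where
  "colon R M N x = {a \<in> carrier R. a \<odot>\<^bsub>M\<^esub> x \<in> N}"

text \<open>For \<open>N \<subseteq> K\<close>, these are the associated primes of \<open>K / N\<close>.\<close>

definition rel_Ass ::
    "('a, 'r) ring_scheme \<Rightarrow> ('a, 'b, 'm) module_scheme \<Rightarrow> 'b set \<Rightarrow> 'b set \<Rightarrow> 'a set set" where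
  "rel_Ass R M N K = {p. primeideal p R \<and> (\<exists>x\<in>K. p = colon R M N x)}"

definition adjoin ::
    "('a, 'r) ring_scheme \<Rightarrow> ('a, 'b, 'm) module_scheme \<Rightarrow> 'b set \<Rightarrow> 'b \<Rightarrow> 'b set" where
  "adjoin R M N s = {n \<oplus>\<^bsub>M\<^esub> a \<odot>\<^bsub>M\<^esub> s | n a. n \<in> N \<and> a \<in> carrier R}"

text \<open>A nonempty chain of ideals in a Noetherian ring contains its own union, so every chain
  in \<open>S\<close> is bounded within \<open>S\<close> and Zorn's lemma applies.\<close>

lemma (in noetherian_ring) ex_maximal_ideal_in_family:
  assumes "S \<subseteq> {I. ideal I R}" and "S \<noteq> {}"
  shows "\<exists>I\<in>S. \<forall>J\<in>S. I \<subseteq> J \<longrightarrow> J = I"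
proof (rule subset_Zorn)
  fix C assume C: "subset.chain S C"
  show "\<exists>U\<in>S. \<forall>I\<in>C. I \<subseteq> U"
  proof (cases "C = {}")
    case True
    then show ?thesis using assms(2) by auto
  next
    case False
    have "subset.chain {I. ideal I R} C"
      using C assms(1) by (auto simp: subset.chain_def)
    from ideal_chain_is_trivial[OF False this] have "\<Union>C \<in> C" .
    then show ?thesis using C by (auto simp: subset.chain_def)
  qed
qed

section \<open>Colon ideals and primes among them\<close>

context module
begin

lemma submodule_zero_closed: "submodule N R M \<Longrightarrow> \<zero>\<^bsub>M\<^esub> \<in> N"
  using subgroup.one_closed[of N "add_monoid M"] by (simp add: submodule_def)

lemma zero_submodule: "submodule {\<zero>\<^bsub>M\<^esub>} R M"
  by (rule submoduleI) auto

lemma ann_elem_eq_colon: "ann_elem R M x = colon R M {\<zero>\<^bsub>M\<^esub>} x"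
  by (simp add: ann_elem_def colon_def)

lemma Ass_eq_rel_Ass: "Ass R M = rel_Ass R M {\<zero>\<^bsub>M\<^esub>} (carrier M)"
  by (simp add: Ass_def rel_Ass_def ann_elem_eq_colon)

lemma colon_ideal:
  assumes N: "submodule N R M" and x: "x \<in> carrier M"
  shows "ideal (colon R M N x) R"
proof (rule idealI)
  note NE = submoduleE[OF N]
  show "ring R" by (rule R.ring_axioms)
  show "subgroup (colon R M N x) (add_monoid R)"
  proof (rule R.add.subgroupI)
    show "colon R M N x \<subseteq> carrier R" by (auto simp: colon_def)
    show "colon R M N x \<noteq> {}"
      using submodule_zero_closed[OF N] x by (auto simp: colon_def intro!: exI[of _ \<zero>])
    fix a b assume a: "a \<in> colon R M N x" and b: "b \<in> colon R M N x"
    show "\<ominus> a \<in> colon R M N x"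
      using a x NE(3) by (auto simp: colon_def smult_l_minus)
    show "a \<oplus> b \<in> colon R M N x"
      using a b x NE(5) by (auto simp: colon_def smult_l_distr)
  qed
  fix a b assume a: "a \<in> colon R M N x" and b: "b \<in> carrier R"
  show *: "b \<otimes> a \<in> colon R M N x"
    using a b x NE(4) by (auto simp: colon_def smult_assoc1)
  then show "a \<otimes> b \<in> colon R M N x"
    using a b R.m_comm by (auto simp: colon_def)
qed

lemma colon_eq_carrier_iff:
  assumes N: "submodule N R M" and x: "x \<in> carrier M"
  shows "colon R M N x = carrier R \<longleftrightarrow> x \<in> N"
proof
  assume "colon R M N x = carrier R"
  then have "\<one> \<in> colon R M N x" by simp
  then show "x \<in> N" using x by (simp add: colon_def)
next
  assume "x \<in> N"
  then show "colon R M N x = carrier R" using submoduleE(4)[OF N] unfolding colon_def by blast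
qed

lemma colon_smult:
  assumes "a \<in> carrier R" and "x \<in> carrier M"
  shows "colon R M N (a \<odot>\<^bsub>M\<^esub> x) = {b \<in> carrier R. b \<otimes> a \<in> colon R M N x}"
  using assms by (auto simp: colon_def smult_assoc1)

lemma colon_subset_colon_smult:
  assumes "submodule N R M" and "a \<in> carrier R" and "x \<in> carrier M"
  shows "colon R M N x \<subseteq> colon R M N (a \<odot>\<^bsub>M\<^esub> x)"
proof
  fix b assume b: "b \<in> colon R M N x"
  then have "b \<otimes> a \<in> colon R M N x"
    using ideal.I_r_closed[OF colon_ideal[OF assms(1,3)] _ assms(2)] by blast
  moreover have "b \<in> carrier R" using b by (simp add: colon_def)
  ultimately show "b \<in> colon R M N (a \<odot>\<^bsub>M\<^esub> x)" using assms by (simp add: colon_smult)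
qed

text \<open>\<open>(N : a x)\<close> is the ideal quotient of \<open>p = (N : x)\<close> by
  \<open>a\<close>, and a prime \<open>p\<close> with \<open>a \<notin> p\<close> satisfies
  \<open>(p : a) = p\<close>.\<close>

lemma colon_smult_prime:
  assumes p: "primeideal (colon R M N x) R" and x: "x \<in> carrier M"
    and a: "a \<in> carrier R" "a \<notin> colon R M N x"
  shows "colon R M N (a \<odot>\<^bsub>M\<^esub> x) = colon R M N x"
proof -
  interpret primeideal "colon R M N x" R by fact
  show ?thesis
    unfolding colon_smult[OF a(1) x] using a I_prime[of _ a] I_r_closed[OF _ a(1)] Icarr by blast
qed

text \<open>Among the ideals \<open>(N : a x)\<close> with \<open>a x \<notin> N\<close>, all of
  them proper, a maximal one \<open>I\<close> is prime: if \<open>b c \<in> I\<close> and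
  \<open>c \<notin> I\<close>, then \<open>(N : c a x)\<close> belongs to the family and contains
  both \<open>I\<close> and \<open>b\<close>, so maximality gives \<open>b \<in> I\<close>.\<close>

lemma ex_prime_colon:
  assumes noeth: "noetherian_ring R" and N: "submodule N R M"
    and x: "x \<in> carrier M" "x \<notin> N"
  shows "\<exists>a\<in>carrier R. primeideal (colon R M N (a \<odot>\<^bsub>M\<^esub> x)) R"
proof -
  define S where "S = (\<lambda>a. colon R M N (a \<odot>\<^bsub>M\<^esub> x)) ` {a \<in> carrier R. a \<odot>\<^bsub>M\<^esub> x \<notin> N}"
  have "S \<subseteq> {I. ideal I R}" using colon_ideal[OF N] x by (auto simp: S_def)
  moreover have "S \<noteq> {}" using x by (auto simp: S_def intro!: exI[of _ \<one>])
  ultimately obtain I where "I \<in> S" and max: "\<And>J. J \<in> S \<Longrightarrow> I \<subseteq> J \<Longrightarrow> J = I"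
    using noetherian_ring.ex_maximal_ideal_in_family[OF noeth] by metis
  then obtain a where a: "a \<in> carrier R" "a \<odot>\<^bsub>M\<^esub> x \<notin> N" and I: "I = colon R M N (a \<odot>\<^bsub>M\<^esub> x)"
    by (auto simp: S_def)
  have ax: "a \<odot>\<^bsub>M\<^esub> x \<in> carrier M" using a x by simp
  have "primeideal I R"
  proof (rule primeidealI)
    show "ideal I R" using colon_ideal[OF N ax] I by simp
    show "cring R" by (rule R.is_cring)
    show "carrier R \<noteq> I" using colon_eq_carrier_iff[OF N ax] a I by auto
    fix b c assume b: "b \<in> carrier R" and c: "c \<in> carrier R" and bc: "b \<otimes> c \<in> I"
    show "b \<in> I \<or> c \<in> I"
    proof (cases "c \<in> I")
      case False
      have "(c \<otimes> a) \<odot>\<^bsub>M\<^esub> x \<notin> N"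
        using False a c x by (auto simp: I colon_def smult_assoc1)
      then have "colon R M N ((c \<otimes> a) \<odot>\<^bsub>M\<^esub> x) \<in> S" using a c by (auto simp: S_def)
      moreover have "I \<subseteq> colon R M N ((c \<otimes> a) \<odot>\<^bsub>M\<^esub> x)"
        using colon_subset_colon_smult[OF N c ax] a c x by (simp add: I smult_assoc1)
      ultimately have "colon R M N ((c \<otimes> a) \<odot>\<^bsub>M\<^esub> x) = I" using max by blast
      moreover have "b \<in> colon R M N ((c \<otimes> a) \<odot>\<^bsub>M\<^esub> x)"
        using bc a b c x by (auto simp: I colon_def smult_assoc1)
      ultimately show ?thesis by simp
    qed simp
  qed
  then show ?thesis using a I by blast
qed

section \<open>Adjoining one element to a submodule, and finiteness of the set of associated
  primes\<close>

lemma adjoinI: "n \<in> N \<Longrightarrow> a \<in> carrier R \<Longrightarrow> n \<oplus>\<^bsub>M\<^esub> a \<odot>\<^bsub>M\<^esub> s \<in> adjoin R M N s"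
  unfolding adjoin_def by blast

lemma adjoin_submodule:
  assumes N: "submodule N R M" and s: "s \<in> carrier M"
  shows "submodule (adjoin R M N s) R M"
proof -
  note NE = submoduleE[OF N]
  have Nc: "n \<in> carrier M" if "n \<in> N" for n using that NE(1) by blast
  show ?thesis
  proof (rule submoduleI)
    show "adjoin R M N s \<subseteq> carrier M" using Nc s by (auto simp: adjoin_def)
    show "\<zero>\<^bsub>M\<^esub> \<in> adjoin R M N s"
      using adjoinI[of "\<zero>\<^bsub>M\<^esub>" N \<zero> s] submodule_zero_closed[OF N] s by simp
  next
    fix y assume "y \<in> adjoin R M N s"
    then obtain n a where y: "y = n \<oplus>\<^bsub>M\<^esub> a \<odot>\<^bsub>M\<^esub> s" and n: "n \<in> N" and a: "a \<in> carrier R"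
      unfolding adjoin_def by blast
    have "\<ominus>\<^bsub>M\<^esub> y = \<ominus>\<^bsub>M\<^esub> n \<oplus>\<^bsub>M\<^esub> (\<ominus> a) \<odot>\<^bsub>M\<^esub> s"
      using y n a s Nc by (simp add: M.minus_add smult_l_minus)
    then show "\<ominus>\<^bsub>M\<^esub> y \<in> adjoin R M N s" using n a NE(3) by (simp add: adjoinI)
    fix b assume b: "b \<in> carrier R"
    have "b \<odot>\<^bsub>M\<^esub> y = b \<odot>\<^bsub>M\<^esub> n \<oplus>\<^bsub>M\<^esub> (b \<otimes> a) \<odot>\<^bsub>M\<^esub> s"
      using y n a b s Nc by (simp add: smult_r_distr smult_assoc1)
    then show "b \<odot>\<^bsub>M\<^esub> y \<in> adjoin R M N s" using n a b NE(4) by (simp add: adjoinI)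
  next
    fix y z assume "y \<in> adjoin R M N s" "z \<in> adjoin R M N s"
    then obtain n a m b where y: "y = n \<oplus>\<^bsub>M\<^esub> a \<odot>\<^bsub>M\<^esub> s" "n \<in> N" "a \<in> carrier R"
      and z: "z = m \<oplus>\<^bsub>M\<^esub> b \<odot>\<^bsub>M\<^esub> s" "m \<in> N" "b \<in> carrier R"
      unfolding adjoin_def by blast
    have "y \<oplus>\<^bsub>M\<^esub> z = (n \<oplus>\<^bsub>M\<^esub> m) \<oplus>\<^bsub>M\<^esub> (a \<oplus> b) \<odot>\<^bsub>M\<^esub> s"
      using y z s Nc by (simp add: smult_l_distr M.a_ac)
    then show "y \<oplus>\<^bsub>M\<^esub> z \<in> adjoin R M N s" using y z NE(5) by (simp add: adjoinI)
  qed
qed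

lemma subset_adjoin:
  assumes N: "submodule N R M" and s: "s \<in> carrier M"
  shows "N \<subseteq> adjoin R M N s"
proof
  fix n assume n: "n \<in> N"
  then have "n = n \<oplus>\<^bsub>M\<^esub> \<zero> \<odot>\<^bsub>M\<^esub> s" using s submoduleE(1)[OF N] by auto
  with n show "n \<in> adjoin R M N s" by (metis adjoinI R.zero_closed)
qed

lemma self_mem_adjoin:
  assumes N: "submodule N R M" and s: "s \<in> carrier M"
  shows "s \<in> adjoin R M N s"
proof -
  have "s = \<zero>\<^bsub>M\<^esub> \<oplus>\<^bsub>M\<^esub> \<one> \<odot>\<^bsub>M\<^esub> s" using s by simp
  with submodule_zero_closed[OF N] show ?thesis by (metis adjoinI R.one_closed)
qed

lemma adjoin_least:
  assumes "submodule K R M" and "N \<subseteq> K" and "s \<in> K"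
  shows "adjoin R M N s \<subseteq> K"
  using submoduleE(4,5)[OF assms(1)] assms(2,3) unfolding adjoin_def by blast

lemma submodule_add_mem_iff:
  assumes N: "submodule N R M" and n: "n \<in> N" and x: "x \<in> carrier M"
  shows "n \<oplus>\<^bsub>M\<^esub> x \<in> N \<longleftrightarrow> x \<in> N"
proof
  have nc: "n \<in> carrier M" using n submoduleE(1)[OF N] by blast
  assume "n \<oplus>\<^bsub>M\<^esub> x \<in> N"
  then have "\<ominus>\<^bsub>M\<^esub> n \<oplus>\<^bsub>M\<^esub> (n \<oplus>\<^bsub>M\<^esub> x) \<in> N" using n submoduleE(3,5)[OF N] by blast
  then show "x \<in> N" using nc x by (simp add: M.r_neg1)
qed (use n submoduleE(5)[OF N] in blast)

text \<open>A prime \<open>p = (N : x)\<close> either equals \<open>(K : x)\<close>, or some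
  multiple \<open>a x\<close> with \<open>a \<notin> p\<close> lies in \<open>K\<close>; in the
  second case \<open>(N : a x)\<close> is still \<open>p\<close>. For submodules
  \<open>N \<subseteq> K \<subseteq> L\<close> this is the usual bound on the associated primes of
  an extension of \<open>L / K\<close> by \<open>K / N\<close>.\<close>

lemma rel_Ass_trans:
  assumes N: "submodule N R M" and "N \<subseteq> K" and L: "L \<subseteq> carrier M"
  shows "rel_Ass R M N L \<subseteq> rel_Ass R M N K \<union> rel_Ass R M K L"
proof
  fix p assume "p \<in> rel_Ass R M N L"
  then obtain x where p: "primeideal p R" and x: "x \<in> L" and px: "p = colon R M N x"
    by (auto simp: rel_Ass_def)
  have xc: "x \<in> carrier M" using x L by blast
  show "p \<in> rel_Ass R M N K \<union> rel_Ass R M K L"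
  proof (cases "colon R M K x = p")
    case True
    then show ?thesis using p x by (auto simp: rel_Ass_def)
  next
    case False
    moreover have "p \<subseteq> colon R M K x" using \<open>N \<subseteq> K\<close> by (auto simp: px colon_def)
    ultimately obtain a where a: "a \<in> carrier R" "a \<odot>\<^bsub>M\<^esub> x \<in> K" "a \<notin> p"
      by (auto simp: colon_def)
    then have "colon R M N (a \<odot>\<^bsub>M\<^esub> x) = p" using colon_smult_prime p px xc by blast
    then show ?thesis using a p by (auto simp: rel_Ass_def)
  qed
qed

text \<open>With \<open>p = (N : s)\<close>, the quotient of \<open>N + R s\<close> by
  \<open>N\<close> is isomorphic to \<open>R / p\<close>, where every nonzero element has
  annihilator \<open>p\<close>.\<close>

lemma rel_Ass_adjoin_subset:
  assumes N: "submodule N R M" and s: "s \<in> carrier M" and p: "primeideal (colon R M N s) R"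
  shows "rel_Ass R M N (adjoin R M N s) \<subseteq> {colon R M N s}"
proof
  fix q assume "q \<in> rel_Ass R M N (adjoin R M N s)"
  then obtain n a where q: "primeideal q R" and n: "n \<in> N" and a: "a \<in> carrier R"
    and qeq: "q = colon R M N (n \<oplus>\<^bsub>M\<^esub> a \<odot>\<^bsub>M\<^esub> s)"
    unfolding rel_Ass_def adjoin_def by blast
  have nc: "n \<in> carrier M" using n submoduleE(1)[OF N] by blast
  \<comment> \<open>The summand \<open>n\<close> lies in \<open>N\<close> and does not affect the
    colon, so \<open>q = (N : a s)\<close>.\<close>
  have "b \<odot>\<^bsub>M\<^esub> (n \<oplus>\<^bsub>M\<^esub> a \<odot>\<^bsub>M\<^esub> s) \<in> N \<longleftrightarrow> b \<odot>\<^bsub>M\<^esub> (a \<odot>\<^bsub>M\<^esub> s) \<in> N" if b: "b \<in> carrier R" for b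
    using submodule_add_mem_iff[OF N submoduleE(4)[OF N b n], of "b \<odot>\<^bsub>M\<^esub> (a \<odot>\<^bsub>M\<^esub> s)"] a b nc s
    by (simp add: smult_r_distr)
  then have q2: "q = colon R M N (a \<odot>\<^bsub>M\<^esub> s)" by (auto simp: qeq colon_def)
  have "a \<odot>\<^bsub>M\<^esub> s \<notin> N"
    using colon_eq_carrier_iff[OF N, of "a \<odot>\<^bsub>M\<^esub> s"] a s q q2 primeideal.I_notcarr by fastforce
  then have "a \<notin> colon R M N s" by (simp add: colon_def)
  then show "q \<in> {colon R M N s}" using colon_smult_prime[OF p s a] q2 by simp
qed

text \<open>Noetherian induction on \<open>(K : s)\<close> for \<open>N \<subseteq> K \<subseteq> N + R s\<close> takes place among ideals of \<open>R\<close>, so that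
  the ascending chain condition for submodules of \<open>M\<close> is not needed.\<close>

lemma finite_rel_Ass_adjoin:
  assumes noeth: "noetherian_ring R" and N: "submodule N R M" and s: "s \<in> carrier M"
    and fin: "finite (rel_Ass R M {\<zero>\<^bsub>M\<^esub>} N)"
  shows "finite (rel_Ass R M {\<zero>\<^bsub>M\<^esub>} (adjoin R M N s))"
proof -
  define F where "F = {K. submodule K R M \<and> N \<subseteq> K \<and> K \<subseteq> adjoin R M N s \<and>
    finite (rel_Ass R M {\<zero>\<^bsub>M\<^esub>} K)}"
  have "(\<lambda>K. colon R M K s) ` F \<subseteq> {I. ideal I R}"
    using colon_ideal[OF _ s] unfolding F_def by blast
  moreover have "N \<in> F" using N fin subset_adjoin[OF N s] by (auto simp: F_def)
  ultimately have "\<exists>I\<in>(\<lambda>K. colon R M K s) ` F. \<forall>J\<in>(\<lambda>K. colon R M K s) ` F. I \<subseteq> J \<longrightarrow> J = I"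
    by (intro noetherian_ring.ex_maximal_ideal_in_family[OF noeth]) blast+
  then obtain K where K: "K \<in> F"
    and max: "\<And>L. L \<in> F \<Longrightarrow> colon R M K s \<subseteq> colon R M L s \<Longrightarrow> colon R M L s = colon R M K s"
    by blast
  have Ks: "submodule K R M" using K by (simp add: F_def)
  \<comment> \<open>Otherwise \<open>K\<close> is enlarged by a multiple \<open>a s\<close> whose
    colon is prime. This adds at most one associated prime, so \<open>L\<close> stays in
    \<open>F\<close>; but \<open>a\<close> lies in \<open>(L : s)\<close> and not in
    \<open>(K : s)\<close>, against maximality.\<close>
  have "s \<in> K"
  proof (rule ccontr)
    assume "s \<notin> K"
    then obtain a where a: "a \<in> carrier R" and pr: "primeideal (colon R M K (a \<odot>\<^bsub>M\<^esub> s)) R"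
      using ex_prime_colon[OF noeth Ks s] by blast
    define L where "L = adjoin R M K (a \<odot>\<^bsub>M\<^esub> s)"
    have as: "a \<odot>\<^bsub>M\<^esub> s \<in> carrier M" using a s by simp
    have L: "submodule L R M" unfolding L_def by (rule adjoin_submodule[OF Ks as])
    have KL: "K \<subseteq> L" unfolding L_def by (rule subset_adjoin[OF Ks as])
    have ext: "submodule (adjoin R M N s) R M" by (rule adjoin_submodule[OF N s])
    have "L \<subseteq> adjoin R M N s"
      unfolding L_def using K a submoduleE(4)[OF ext _ self_mem_adjoin[OF N s]]
      by (intro adjoin_least[OF ext]) (auto simp: F_def)
    moreover have "finite (rel_Ass R M {\<zero>\<^bsub>M\<^esub>} L)"
    proof (rule finite_subset)
      show "rel_Ass R M {\<zero>\<^bsub>M\<^esub>} L \<subseteq> rel_Ass R M {\<zero>\<^bsub>M\<^esub>} K \<union> {colon R M K (a \<odot>\<^bsub>M\<^esub> s)}"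
        using rel_Ass_trans[OF zero_submodule, of K L] submodule_zero_closed[OF Ks]
          submoduleE(1)[OF L] rel_Ass_adjoin_subset[OF Ks as pr]
        by (auto simp: L_def)
    qed (use K in \<open>simp add: F_def\<close>)
    ultimately have "L \<in> F" using L K KL by (auto simp: F_def)
    moreover have "colon R M K s \<subseteq> colon R M L s" using KL by (auto simp: colon_def)
    ultimately have "colon R M L s = colon R M K s" by (rule max)
    moreover have "a \<in> colon R M L s"
      using a self_mem_adjoin[OF Ks as] by (simp add: colon_def L_def)
    ultimately have "a \<odot>\<^bsub>M\<^esub> s \<in> K" by (simp add: colon_def)
    then show False
      using pr colon_eq_carrier_iff[OF Ks as] primeideal.I_notcarr by fastforce
  qed
  then have "adjoin R M N s = K"
    using adjoin_least[OF Ks, of N s] K by (auto simp: F_def)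
  then show ?thesis using K by (simp add: F_def)
qed

text \<open>Starting from the zero submodule, finitely many generators are adjoined one at a time,
  and each step preserves finiteness.\<close>

lemma finite_Ass:
  assumes noeth: "noetherian_ring R" and fg: "fin_gen_module R M"
  shows "finite (Ass R M)"
proof -
  obtain S where S: "S \<subseteq> carrier M" "finite S" "gen_submodule R M S = carrier M"
    using fg unfolding fin_gen_module_def by blast
  \<comment> \<open>Any submodule containing the generators will do, since it is then all of
    \<open>M\<close>.\<close>
  have "\<exists>N. submodule N R M \<and> S \<subseteq> N \<and> finite (rel_Ass R M {\<zero>\<^bsub>M\<^esub>} N)"
    using S(2,1)
  proof (induction S)
    case empty
    have "rel_Ass R M {\<zero>\<^bsub>M\<^esub>} {\<zero>\<^bsub>M\<^esub>} \<subseteq> {colon R M {\<zero>\<^bsub>M\<^esub>} \<zero>\<^bsub>M\<^esub>}"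
      by (auto simp: rel_Ass_def)
    then have "finite (rel_Ass R M {\<zero>\<^bsub>M\<^esub>} {\<zero>\<^bsub>M\<^esub>})" by (rule finite_subset) simp
    then show ?case using zero_submodule by blast
  next
    case (insert s S)
    then obtain N where N: "submodule N R M" "S \<subseteq> N" "finite (rel_Ass R M {\<zero>\<^bsub>M\<^esub>} N)" by auto
    have s: "s \<in> carrier M" using insert.prems by simp
    have "insert s S \<subseteq> adjoin R M N s"
      using subset_adjoin[OF N(1) s] self_mem_adjoin[OF N(1) s] N(2) by blast
    then show ?case
      using adjoin_submodule[OF N(1) s] finite_rel_Ass_adjoin[OF noeth N(1) s N(3)] by blast
  qed
  then obtain N where N: "submodule N R M" "S \<subseteq> N" "finite (rel_Ass R M {\<zero>\<^bsub>M\<^esub>} N)" by blast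
  have "carrier M \<subseteq> N" using N S(3) unfolding gen_submodule_def by blast
  then have "carrier M = N" using submoduleE(1)[OF N(1)] by blast
  then show ?thesis using N(3) by (simp add: Ass_eq_rel_Ass)
qed

end

section \<open>Products and powers of ideals\<close>

context cring
begin

lemma ideals_set_simps:
  "carrier (ideals_set R) = {I. ideal I R}"
  "I \<otimes>\<^bsub>ideals_set R\<^esub> J = I \<cdot> J"
  "\<one>\<^bsub>ideals_set R\<^esub> = carrier R"
  by (simp_all add: ideals_set_def)

lemma finprod_ideals_ideal:
  assumes "\<And>q. q \<in> Q \<Longrightarrow> ideal q R"
  shows "ideal (\<Otimes>\<^bsub>ideals_set R\<^esub>q\<in>Q. q) R"
proof -
  have "(\<lambda>q. q) \<in> Q \<rightarrow> carrier (ideals_set R)" using assms by (simp add: ideals_set_simps)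
  from comm_monoid.finprod_closed[OF ideals_set_is_comm_monoid this] show ?thesis
    by (simp add: ideals_set_simps)
qed

lemma finprod_ideals_insert:
  assumes "finite Q" and "q \<notin> Q" and "\<And>r. r \<in> insert q Q \<Longrightarrow> ideal r R"
  shows "(\<Otimes>\<^bsub>ideals_set R\<^esub>r\<in>insert q Q. r) = q \<cdot> (\<Otimes>\<^bsub>ideals_set R\<^esub>r\<in>Q. r)"
proof -
  have "(\<lambda>q. q) \<in> Q \<rightarrow> carrier (ideals_set R)" "q \<in> carrier (ideals_set R)"
    using assms(3) by (simp_all add: ideals_set_simps)
  from comm_monoid.finprod_insert[OF ideals_set_is_comm_monoid assms(1,2) this] show ?thesis
    by (simp add: ideals_set_simps)
qed

lemma finprod_ideals_subset:
  assumes "finite Q" and "\<And>q. q \<in> Q \<Longrightarrow> ideal q R" and "q \<in> Q"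
  shows "(\<Otimes>\<^bsub>ideals_set R\<^esub>r\<in>Q. r) \<subseteq> q"
proof -
  have Q: "insert q (Q - {q}) = Q" using assms(3) by blast
  have "(\<Otimes>\<^bsub>ideals_set R\<^esub>r\<in>insert q (Q - {q}). r) = q \<cdot> (\<Otimes>\<^bsub>ideals_set R\<^esub>r\<in>Q - {q}. r)"
    using assms by (intro finprod_ideals_insert) auto
  also have "\<dots> \<subseteq> q \<inter> (\<Otimes>\<^bsub>ideals_set R\<^esub>r\<in>Q - {q}. r)"
    using assms(2,3) by (intro ideal_prod_inter finprod_ideals_ideal) auto
  finally show ?thesis unfolding Q by blast
qed

lemma prime_ideal_prod_subset:
  assumes "primeideal p R" and "ideal I R" and "ideal J R" and "I \<cdot> J \<subseteq> p"
  shows "I \<subseteq> p \<or> J \<subseteq> p"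
proof (rule ccontr)
  assume "\<not> (I \<subseteq> p \<or> J \<subseteq> p)"
  then obtain i j where ij: "i \<in> I" "i \<notin> p" "j \<in> J" "j \<notin> p" by blast
  moreover have "i \<in> carrier R" "j \<in> carrier R"
    using ij ideal.Icarr[OF assms(2)] ideal.Icarr[OF assms(3)] by blast+
  moreover have "i \<otimes> j \<in> p" by (rule subsetD[OF assms(4) ideal_prod.prod[OF ij(1,3)]])
  ultimately show False using primeideal.I_prime[OF assms(1)] by blast
qed

lemma prime_finprod_ideals_subset:
  assumes "finite Q" and "\<And>q. q \<in> Q \<Longrightarrow> ideal q R" and "primeideal p R"
    and "(\<Otimes>\<^bsub>ideals_set R\<^esub>r\<in>Q. r) \<subseteq> p"
  shows "\<exists>q\<in>Q. q \<subseteq> p"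
  using assms(1,2,4)
proof (induction Q)
  \<comment> \<open>The empty product is the unit ideal, which no prime contains, so the assumed
    inclusion is contradictory here.\<close>
  case empty
  interpret primeideal p R by fact
  have "carrier R \<subseteq> p"
    using empty.prems(2) comm_monoid.finprod_empty[OF ideals_set_is_comm_monoid, of "\<lambda>q. q"]
    by (simp add: ideals_set_simps)
  then show ?case using I_notcarr a_subset by blast
next
  case (insert q Q)
  then have "q \<cdot> (\<Otimes>\<^bsub>ideals_set R\<^esub>r\<in>Q. r) \<subseteq> p" using finprod_ideals_insert[of Q q] by simp
  then have "q \<subseteq> p \<or> (\<Otimes>\<^bsub>ideals_set R\<^esub>r\<in>Q. r) \<subseteq> p"
    using assms(3) insert.prems(1) finprod_ideals_ideal[of Q]
    by (intro prime_ideal_prod_subset) auto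
  then show ?case using insert.IH insert.prems(1) by blast
qed

lemma ideal_pow_0: "I [^]\<^bsub>ideals_set R\<^esub> (0::nat) = carrier R"
  by (simp add: ideals_set_simps)

lemma ideal_pow_Suc: "I [^]\<^bsub>ideals_set R\<^esub> Suc n = (I [^]\<^bsub>ideals_set R\<^esub> n) \<cdot> I"
  by (simp add: ideals_set_simps)

lemma ideal_pow_ideal: "ideal I R \<Longrightarrow> ideal (I [^]\<^bsub>ideals_set R\<^esub> (n::nat)) R"
  by (induction n) (simp_all only: ideal_pow_0 ideal_pow_Suc oneideal ideal_prod_is_ideal)

lemma ideal_pow_antimono:
  assumes I: "ideal I R" and "m \<le> n"
  shows "I [^]\<^bsub>ideals_set R\<^esub> (n::nat) \<subseteq> I [^]\<^bsub>ideals_set R\<^esub> (m::nat)"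
  using assms(2)
proof (induction rule: dec_induct)
  case (step k)
  then show ?case
    using ideal_prod_inter[OF ideal_pow_ideal[OF I, of k] I] unfolding ideal_pow_Suc by blast
qed simp

lemma prime_ideal_pow_subset:
  assumes "primeideal p R" and I: "ideal I R" and "I [^]\<^bsub>ideals_set R\<^esub> (n::nat) \<subseteq> p"
  shows "I \<subseteq> p"
  using assms(3)
proof (induction n)
  \<comment> \<open>The zeroth power is the unit ideal, so its inclusion in \<open>p\<close> already
    gives that of \<open>I\<close>.\<close>
  case 0
  then show ?case using ideal.Icarr[OF I] unfolding ideal_pow_0 by blast
next
  case (Suc n)
  then show ?case
    using prime_ideal_prod_subset[OF assms(1) ideal_pow_ideal[OF I] I] unfolding ideal_pow_Suc by blast
qed

end

section \<open>Annihilators of ideal powers and torsion\<close>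

context module
begin

lemma ann_ideal_submodule:
  assumes I: "I \<subseteq> carrier R"
  shows "submodule (ann_ideal M I) R M"
proof (rule submoduleI)
  have c: "b \<in> carrier R" if "b \<in> I" for b using that I by blast
  show "ann_ideal M I \<subseteq> carrier M" "\<zero>\<^bsub>M\<^esub> \<in> ann_ideal M I"
    using c by (auto simp: ann_ideal_def)
  fix x assume x: "x \<in> ann_ideal M I"
  then show "\<ominus>\<^bsub>M\<^esub> x \<in> ann_ideal M I" using c by (auto simp: ann_ideal_def smult_r_minus)
  {
    fix y assume "y \<in> ann_ideal M I"
    with x show "x \<oplus>\<^bsub>M\<^esub> y \<in> ann_ideal M I" using c by (auto simp: ann_ideal_def smult_r_distr)
  }
  fix a assume a: "a \<in> carrier R"
  have "b \<odot>\<^bsub>M\<^esub> (a \<odot>\<^bsub>M\<^esub> x) = a \<odot>\<^bsub>M\<^esub> (b \<odot>\<^bsub>M\<^esub> x)" if "b \<in> I" for b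
    using x a c[OF that] by (simp add: ann_ideal_def R.m_comm flip: smult_assoc1)
  then show "a \<odot>\<^bsub>M\<^esub> x \<in> ann_ideal M I" using x a by (simp add: ann_ideal_def)
qed

lemma ann_ideal_pow_mono:
  assumes "ideal I R" and "m \<le> n"
  shows "ann_ideal M (I [^]\<^bsub>ideals_set R\<^esub> (m::nat)) \<subseteq> ann_ideal M (I [^]\<^bsub>ideals_set R\<^esub> (n::nat))"
  using R.ideal_pow_antimono[OF assms] by (auto simp: ann_ideal_def)

text \<open>The exponent 0, absent from \<open>torsion\<close>, adds nothing because the
  annihilators increase with the exponent.\<close>

lemma torsion_eq_UN:
  assumes I: "ideal I R"
  shows "torsion R M I = (\<Union>n::nat. ann_ideal M (I [^]\<^bsub>ideals_set R\<^esub> n))"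
proof
  show "(\<Union>n::nat. ann_ideal M (I [^]\<^bsub>ideals_set R\<^esub> n)) \<subseteq> torsion R M I"
  proof
    fix y assume "y \<in> (\<Union>n::nat. ann_ideal M (I [^]\<^bsub>ideals_set R\<^esub> n))"
    then obtain n :: nat where "y \<in> ann_ideal M (I [^]\<^bsub>ideals_set R\<^esub> n)" by blast
    then have "y \<in> ann_ideal M (I [^]\<^bsub>ideals_set R\<^esub> Suc n)"
      using ann_ideal_pow_mono[OF I le_SucI[OF order_refl]] by blast
    moreover have "Suc n \<in> {1..}" by simp
    ultimately show "y \<in> torsion R M I" unfolding torsion_def by blast
  qed
qed (unfold torsion_def, blast)

lemma torsion_submodule:
  assumes I: "ideal I R"
  shows "submodule (torsion R M I) R M"
proof -
  define T where "T = (\<lambda>n::nat. ann_ideal M (I [^]\<^bsub>ideals_set R\<^esub> n))"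
  have T: "submodule (T n) R M" for n
    unfolding T_def using ideal.Icarr[OF R.ideal_pow_ideal[OF I]]
    by (intro ann_ideal_submodule) blast
  have mono: "T m \<subseteq> T n" if "m \<le> n" for m n
    unfolding T_def by (rule ann_ideal_pow_mono[OF I that])
  have eq: "torsion R M I = (\<Union>n. T n)" unfolding T_def by (rule torsion_eq_UN[OF I])
  show ?thesis unfolding eq
  proof (rule submoduleI)
    \<comment> \<open>The union is increasing, so two elements have a common stage.\<close>
    fix x y assume "x \<in> (\<Union>n. T n)" "y \<in> (\<Union>n. T n)"
    then obtain m n where "x \<in> T m" "y \<in> T n" by blast
    then have "x \<in> T (max m n)" "y \<in> T (max m n)"
      using mono[of m "max m n"] mono[of n "max m n"] by auto
    then show "x \<oplus>\<^bsub>M\<^esub> y \<in> (\<Union>n. T n)" using submoduleE(5)[OF T] by blast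
  next
    show "(\<Union>n. T n) \<subseteq> carrier M" using submoduleE(1)[OF T] by blast
    show "\<zero>\<^bsub>M\<^esub> \<in> (\<Union>n. T n)" using submodule_zero_closed[OF T] by blast
  next
    fix x assume "x \<in> (\<Union>n. T n)"
    then show "\<ominus>\<^bsub>M\<^esub> x \<in> (\<Union>n. T n)" using submoduleE(3)[OF T] by blast
  next
    fix a x assume "a \<in> carrier R" "x \<in> (\<Union>n. T n)"
    then show "a \<odot>\<^bsub>M\<^esub> x \<in> (\<Union>n. T n)" using submoduleE(4)[OF T] by blast
  qed
qed

text \<open>The colons into the stages of the torsion form an increasing chain of ideals with union
  \<open>(T : x)\<close>, where \<open>T\<close> is the torsion, and a chain of ideals in a
  Noetherian ring contains its union. Hence one exponent serves all scalars that carry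
  \<open>x\<close> into \<open>T\<close>.\<close>

lemma colon_torsion_stable:
  assumes noeth: "noetherian_ring R" and I: "ideal I R" and x: "x \<in> carrier M"
  shows "\<exists>n::nat. colon R M (torsion R M I) x = colon R M (ann_ideal M (I [^]\<^bsub>ideals_set R\<^esub> n)) x"
proof -
  define J where "J = (\<lambda>n::nat. colon R M (ann_ideal M (I [^]\<^bsub>ideals_set R\<^esub> n)) x)"
  have "ideal (J n) R" for n
    unfolding J_def using ideal.Icarr[OF R.ideal_pow_ideal[OF I]] x
    by (intro colon_ideal ann_ideal_submodule) blast
  moreover have mono: "J m \<subseteq> J n" if "m \<le> n" for m n
    using ann_ideal_pow_mono[OF I that] by (auto simp: J_def colon_def)
  ultimately have "subset.chain {I. ideal I R} (range J)"
    unfolding subset_chain_def using nat_le_linear by blast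
  then have "\<Union>(range J) \<in> range J"
    by (intro noetherian_ring.ideal_chain_is_trivial[OF noeth]) auto
  moreover have "colon R M (torsion R M I) x = \<Union>(range J)"
    by (auto simp: torsion_eq_UN[OF I] J_def colon_def)
  ultimately show ?thesis by (auto simp: J_def)
qed

text \<open>If \<open>V^n\<close> annihilates \<open>x\<close>, then \<open>V^n\<close> is contained
  in the annihilator of \<open>x\<close>, and primality removes the exponent.\<close>

lemma torsion_ann_prime:
  assumes p: "primeideal (ann_elem R M x) R" and V: "ideal V R" and x: "x \<in> torsion R M V"
  shows "V \<subseteq> ann_elem R M x"
proof -
  obtain n :: nat where "x \<in> ann_ideal M (V [^]\<^bsub>ideals_set R\<^esub> n)"
    using x unfolding torsion_def by blast
  then have "V [^]\<^bsub>ideals_set R\<^esub> n \<subseteq> ann_elem R M x"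
    using ideal.Icarr[OF R.ideal_pow_ideal[OF V]] unfolding ann_ideal_def ann_elem_def by blast
  then show ?thesis using R.prime_ideal_pow_subset[OF p V] by blast
qed

text \<open>A multiple \<open>y\<close> of \<open>x\<close> provides an associated prime
  \<open>q\<close> of \<open>M / T\<close>, where \<open>T\<close> is the torsion. Multiplying
  \<open>y\<close> by an element of a power of \<open>V\<close> outside \<open>q\<close> realizes
  the same prime as an annihilator in \<open>M\<close>.\<close>

lemma ex_Ass_not_torsion:
  assumes noeth: "noetherian_ring R" and V: "ideal V R"
    and x: "x \<in> carrier M" "x \<notin> torsion R M V"
  shows "\<exists>q\<in>Ass R M. ann_elem R M x \<subseteq> q \<and> \<not> V \<subseteq> q"
proof -
  let ?T = "torsion R M V"
  have T: "submodule ?T R M" by (rule torsion_submodule[OF V])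
  obtain a where a: "a \<in> carrier R" and pr: "primeideal (colon R M ?T (a \<odot>\<^bsub>M\<^esub> x)) R"
    using ex_prime_colon[OF noeth T x] by blast
  define y where "y = a \<odot>\<^bsub>M\<^esub> x"
  define q where "q = colon R M ?T y"
  have y: "y \<in> carrier M" using a x by (simp add: y_def)
  have ann_q: "b \<in> q" if "b \<in> carrier R" "b \<odot>\<^bsub>M\<^esub> y = \<zero>\<^bsub>M\<^esub>" for b
    using that submodule_zero_closed[OF T] unfolding q_def colon_def by simp
  interpret q: primeideal q R using pr by (simp add: q_def y_def)
  \<comment> \<open>For this \<open>n\<close>, every product of an element of \<open>q\<close> with
    an element of \<open>V^n\<close> annihilates \<open>y\<close>.\<close>
  obtain n :: nat where n: "q = colon R M (ann_ideal M (V [^]\<^bsub>ideals_set R\<^esub> n)) y"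
    using colon_torsion_stable[OF noeth V y] q_def by blast
  note Vn = ideal.Icarr[OF R.ideal_pow_ideal[OF V]]
  have nV: "\<not> V \<subseteq> q"
  proof
    assume Vq: "V \<subseteq> q"
    \<comment> \<open>If \<open>V \<subseteq> q\<close>, then \<open>V^(n+1)\<close> annihilates
      \<open>y\<close>, which puts \<open>y\<close> into the torsion and makes \<open>q\<close>
      improper. Membership in \<open>carrier R\<close> is part of the induction because
      distributivity requires it for sums.\<close>
    have "s \<odot>\<^bsub>M\<^esub> y = \<zero>\<^bsub>M\<^esub> \<and> s \<in> carrier R"
      if "s \<in> V [^]\<^bsub>ideals_set R\<^esub> Suc n" for s
      using that unfolding R.ideal_pow_Suc
    proof (induction s rule: ideal_prod.induct)
      case (prod i j)
      have ij: "i \<in> carrier R" "j \<in> carrier R" using Vn[OF prod(1)] ideal.Icarr[OF V prod(2)] .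
      have "j \<in> q" using Vq prod(2) by blast
      then have "i \<odot>\<^bsub>M\<^esub> (j \<odot>\<^bsub>M\<^esub> y) = \<zero>\<^bsub>M\<^esub>" using prod(1) unfolding n colon_def ann_ideal_def by blast
      with ij y show ?case by (simp add: smult_assoc1)
    next
      case (sum s t)
      then show ?case using y by (simp add: smult_l_distr)
    qed
    then have "y \<in> ann_ideal M (V [^]\<^bsub>ideals_set R\<^esub> Suc n)"
      using y unfolding ann_ideal_def by blast
    then have "y \<in> ?T" unfolding torsion_eq_UN[OF V] by blast
    then show False using colon_eq_carrier_iff[OF T y] q.I_notcarr q_def by simp
  qed
  then have "\<not> V [^]\<^bsub>ideals_set R\<^esub> n \<subseteq> q"
    using R.prime_ideal_pow_subset[OF q.primeideal V] by blast
  then obtain v where v: "v \<in> V [^]\<^bsub>ideals_set R\<^esub> n" "v \<notin> q" by blast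
  have vc: "v \<in> carrier R" using v Vn by blast
  \<comment> \<open>The choice of \<open>n\<close> gives \<open>q v y = 0\<close>. Conversely,
    \<open>b v y = 0\<close> puts \<open>b v\<close> into \<open>q\<close>, and then
    \<open>v \<notin> q\<close> forces \<open>b \<in> q\<close>.\<close>
  have "q = ann_elem R M (v \<odot>\<^bsub>M\<^esub> y)"
  proof
    show "q \<subseteq> ann_elem R M (v \<odot>\<^bsub>M\<^esub> y)"
    proof
      fix b assume b: "b \<in> q"
      then have bc: "b \<in> carrier R" by (rule q.Icarr)
      have "v \<odot>\<^bsub>M\<^esub> (b \<odot>\<^bsub>M\<^esub> y) = \<zero>\<^bsub>M\<^esub>" using b v(1) unfolding n colon_def ann_ideal_def by blast
      then show "b \<in> ann_elem R M (v \<odot>\<^bsub>M\<^esub> y)"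
        using bc vc y by (simp add: ann_elem_def R.m_comm flip: smult_assoc1)
    qed
    show "ann_elem R M (v \<odot>\<^bsub>M\<^esub> y) \<subseteq> q"
    proof
      fix b assume "b \<in> ann_elem R M (v \<odot>\<^bsub>M\<^esub> y)"
      then have b: "b \<in> carrier R" "(b \<otimes> v) \<odot>\<^bsub>M\<^esub> y = \<zero>\<^bsub>M\<^esub>"
        using vc y by (auto simp: ann_elem_def smult_assoc1)
      then have "b \<otimes> v \<in> q" by (intro ann_q R.m_closed vc)
      then show "b \<in> q" using q.I_prime[OF b(1) vc] v(2) by blast
    qed
  qed
  then have "q \<in> Ass R M" using q.primeideal smult_closed[OF vc y] unfolding Ass_def by blast
  moreover have "ann_elem R M x \<subseteq> q"
  proof
    fix b assume "b \<in> ann_elem R M x"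
    then have b: "b \<in> carrier R" and bx: "b \<odot>\<^bsub>M\<^esub> x = \<zero>\<^bsub>M\<^esub>" by (simp_all add: ann_elem_def)
    have "b \<odot>\<^bsub>M\<^esub> y = (a \<otimes> b) \<odot>\<^bsub>M\<^esub> x" using a b x(1) by (simp add: y_def R.m_comm flip: smult_assoc1)
    also have "\<dots> = \<zero>\<^bsub>M\<^esub>" using a b bx x(1) by (simp add: smult_assoc1)
    finally show "b \<in> q" by (rule ann_q[OF b])
  qed
  ultimately show ?thesis using nV by blast
qed

text \<open>A coset depends only on the addition, which is unchanged when the carrier is replaced,
  so the criterion is inherited from \<open>M\<close>.\<close>

lemma coset_eq_iff_mem:
  assumes W: "submodule W R M" and "x \<in> carrier M"
  shows "W +>\<^bsub>M\<lparr>carrier := C\<rparr>\<^esub> x = W \<longleftrightarrow> x \<in> W"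
proof -
  have sub: "subgroup W (add_monoid M)" using W by (simp add: submodule_def)
  have "W +>\<^bsub>M\<lparr>carrier := C\<rparr>\<^esub> x = W +>\<^bsub>M\<^esub> x" by (simp add: a_r_coset_def')
  then show ?thesis
    using M.a_coset_join1[OF _ assms(2) sub] M.a_coset_join2[OF assms(2) sub] by metis
qed

end

section \<open>The v-number as an initial degree\<close>

theorem lemma1p5:
  fixes R :: "('a, 'r) ring_scheme" and M :: "('a, 'b, 'm) module_scheme"
    and Rg :: "nat \<Rightarrow> 'a set" and Mg :: "int \<Rightarrow> 'b set"
    and d :: nat and x :: "nat \<Rightarrow> 'a" and p V :: "'a set" and X\<^sub>p :: "'a set set"
  assumes "noetherian_ring R"
    and "nat_graded_ring R Rg"
    and "\<And>i. i \<in> {1..d} \<Longrightarrow> \<exists>e\<ge>1. x i \<in> Rg e"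
    and "generate_ring R (Rg 0 \<union> x ` {1..d}) = carrier R"
    and "int_graded_module R Rg M Mg"
    and "fin_gen_module R M"
    and "p \<in> Ass R M"
    and "X\<^sub>p = {q \<in> Ass R M. p \<subset> q}"
    and "V = (if X\<^sub>p = {} then carrier R else (\<Otimes>\<^bsub>ideals_set R\<^esub>q\<in>X\<^sub>p. q))"
  shows "v_number R M Mg p =
    (let N = M\<lparr>carrier := ann_ideal M p\<rparr>;
         Ng = (\<lambda>n. ann_ideal M p \<inter> Mg n);
         W = ann_ideal M p \<inter> torsion R M V
     in indeg (quot_module N W) (quot_grading N Ng W))"
proof -
  interpret int_graded_module R Rg M Mg by fact
  have Mg: "additive_subgroup (Mg u) M" for u
    using module_decomp by (simp add: internal_direct_sum_def)
  have Mg0: "\<zero>\<^bsub>M\<^esub> \<in> Mg u" and Mgc: "Mg u \<subseteq> carrier M" for u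
    using additive_subgroup.zero_closed[OF Mg] additive_subgroup.a_subset[OF Mg] by auto
  have p: "primeideal p R" using assms(7) by (simp add: Ass_def)
  interpret p: primeideal p R by fact
  have fin: "finite X\<^sub>p" using finite_Ass[OF assms(1,6)] assms(8) by simp
  have Xid: "ideal q R" if "q \<in> X\<^sub>p" for q
    using that assms(8) primeideal.axioms(1) by (auto simp: Ass_def)
  \<comment> \<open>The empty product in \<open>ideals_set R\<close> is \<open>carrier R\<close>, so
    one formula covers both cases of \<open>V\<close>.\<close>
  have Veq: "V = (\<Otimes>\<^bsub>ideals_set R\<^esub>q\<in>X\<^sub>p. q)"
    using assms(9) comm_monoid.finprod_empty[OF R.ideals_set_is_comm_monoid, of "\<lambda>q. q"]
    by (simp add: R.ideals_set_simps)
  have V: "ideal V R" unfolding Veq using Xid by (rule R.finprod_ideals_ideal)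
  have key: "p = ann_elem R M y \<longleftrightarrow> y \<in> ann_ideal M p \<and> y \<notin> torsion R M V"
    if y: "y \<in> carrier M" for y
  proof
    assume eq: "p = ann_elem R M y"
    \<comment> \<open>Otherwise the prime \<open>p\<close> would contain a factor \<open>q\<close>
      of \<open>V\<close>, although \<open>p \<subset> q\<close>.\<close>
    have "\<not> V \<subseteq> p"
      using R.prime_finprod_ideals_subset[OF fin Xid p] unfolding Veq assms(8) by blast
    then have "y \<notin> torsion R M V" using torsion_ann_prime[OF p[unfolded eq] V] eq by blast
    moreover have "y \<in> ann_ideal M p" using y unfolding eq ann_ideal_def ann_elem_def by blast
    ultimately show "y \<in> ann_ideal M p \<and> y \<notin> torsion R M V" by blast
  next
    assume asm: "y \<in> ann_ideal M p \<and> y \<notin> torsion R M V"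
    then obtain q where q: "q \<in> Ass R M" "ann_elem R M y \<subseteq> q" "\<not> V \<subseteq> q"
      using ex_Ass_not_torsion[OF assms(1) V y] by blast
    \<comment> \<open>\<open>V\<close> is contained in each of its factors, so \<open>q\<close> is
      not one of them. As \<open>p \<subseteq> ann y \<subseteq> q\<close>, this leaves only
      \<open>q = p\<close>.\<close>
    have "q \<notin> X\<^sub>p" using R.finprod_ideals_subset[OF fin Xid] q(3) unfolding Veq by blast
    moreover have "p \<subseteq> ann_elem R M y"
      using asm p.Icarr unfolding ann_ideal_def ann_elem_def by blast
    ultimately show "p = ann_elem R M y" using q assms(8) by blast
  qed
  define W where "W = ann_ideal M p \<inter> torsion R M V"
  have ann: "submodule (ann_ideal M p) R M" by (rule ann_ideal_submodule[OF p.a_subset])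
  note tor = torsion_submodule[OF V]
  have W: "submodule W R M"
    unfolding W_def
  proof (rule submoduleI)
    show "ann_ideal M p \<inter> torsion R M V \<subseteq> carrier M" using submoduleE(1)[OF ann] by blast
    show "\<zero>\<^bsub>M\<^esub> \<in> ann_ideal M p \<inter> torsion R M V"
      using submodule_zero_closed[OF ann] submodule_zero_closed[OF tor] by blast
  qed (simp_all add: submoduleE(3-5)[OF ann] submoduleE(3-5)[OF tor])
  have "quot_grading (M\<lparr>carrier := ann_ideal M p\<rparr>) (\<lambda>n. ann_ideal M p \<inter> Mg n) W u
      \<noteq> {\<zero>\<^bsub>quot_module (M\<lparr>carrier := ann_ideal M p\<rparr>) W\<^esub>}
    \<longleftrightarrow> (\<exists>y\<in>Mg u. p = ann_elem R M y)" (is "?L u \<longleftrightarrow> ?R u") for u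
  proof -
    \<comment> \<open>The component contains zero, so its set of cosets is nonempty and differs from
      \<open>{W}\<close> exactly when some coset differs from \<open>W\<close>.\<close>
    have "?L u \<longleftrightarrow> (\<exists>y\<in>ann_ideal M p \<inter> Mg u. W +>\<^bsub>M\<lparr>carrier := ann_ideal M p\<rparr>\<^esub> y \<noteq> W)"
      using Mg0[of u] submodule_zero_closed[OF ann]
      by (simp only: quot_grading_def quot_module_def ring.select_convs) blast
    also have "\<dots> \<longleftrightarrow> (\<exists>y\<in>ann_ideal M p \<inter> Mg u. y \<notin> W)"
      using Mgc coset_eq_iff_mem[OF W] by blast
    also have "\<dots> \<longleftrightarrow> ?R u" using Mgc key unfolding W_def by blast
    finally show ?thesis .
  qed
  then show ?thesis unfolding v_number_def indeg_def Let_def W_def by simp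
qed

end
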